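(* For all integers $n\ge t\ge2$, $\operatorname{fdim}_t(\mathbf{n})=\dfrac{n-1}{t-1}$, where $\mathbf{n}$ is the $n$-element chain.
   Context: $\mathbf{m}$ denotes the $m$-element chain. A function $f:P\to\mathbf{t}$ is monotone if $x\le y$ implies $f(x)\le f(y)$. A fractional $t$-realiser of a finite poset $P$ is a function $w$ assigning a nonnegative real weight to each monotone (total) function $f:P\to\mathbf{t}$ such that for every pair $x,y\in P$ with $x\not\ge y$, $\sum\{w(f): f(x)<f(y)\}\ge1$. The fractional $t$-dimension $\operatorname{fdim}_t(P)$ is the minimum over all fractional $t$-realisers $w$ of the total weight $\sum_f w(f)$. *)

theory Defs
  imports Complex_Main "HOL-Library.FuncSet"
begin

text \<open>
  A finite poset is given by its carrier \<open>P\<close> and its order relation \<open>le\<close>. The chain with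
  \<open>m\<close> elements is \<open>{1..m}\<close> with the usual order of the natural numbers.
\<close>

definition chain :: "nat \<Rightarrow> nat set" where
  "chain m = {1..m}"

text \<open>
  Functions are extensional, i.e. fixed to a dummy value outside \<open>P\<close>, so that every map from \<open>P\<close>
  to the chain is represented exactly once and, for finite \<open>P\<close>, the sums below are finite.
\<close>

definition monotone_maps :: "'a set \<Rightarrow> ('a \<Rightarrow> 'a \<Rightarrow> bool) \<Rightarrow> nat \<Rightarrow> ('a \<Rightarrow> nat) set" where
  "monotone_maps P le t = {f \<in> P \<rightarrow>\<^sub>E chain t. monotone_on P le (\<le>) f}"

definition fractional_realiser ::
  "nat \<Rightarrow> 'a set \<Rightarrow> ('a \<Rightarrow> 'a \<Rightarrow> bool) \<Rightarrow> (('a \<Rightarrow> nat) \<Rightarrow> real) \<Rightarrow> bool" where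
  "fractional_realiser t P le w \<longleftrightarrow>
     (\<forall>f \<in> monotone_maps P le t. 0 \<le> w f) \<and>
     (\<forall>x \<in> P. \<forall>y \<in> P. \<not> le y x \<longrightarrow>
        1 \<le> (\<Sum>f \<in> {f \<in> monotone_maps P le t. f x < f y}. w f))"

text \<open>
  \<open>LEAST\<close> is the minimum proper, not an infimum: an equation \<open>fdim t P le = c\<close> is obtained by
  exhibiting a fractional realiser of total weight \<open>c\<close> and showing that none has smaller weight.
\<close>

definition fdim :: "nat \<Rightarrow> 'a set \<Rightarrow> ('a \<Rightarrow> 'a \<Rightarrow> bool) \<Rightarrow> real" where
  "fdim t P le =
     (LEAST c. \<exists>w. fractional_realiser t P le w \<and> c = (\<Sum>f \<in> monotone_maps P le t. w f))"

end

theory Submission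
  imports Defs
begin

text \<open>
  On a chain only the pairs of consecutive elements matter. A monotone map to the \<open>t\<close>-chain
  increases at no more than \<open>t - 1\<close> of the \<open>n - 1\<close> gaps between consecutive elements, so adding up
  the constraints of all gaps gives \<open>n - 1 \<le> (t - 1) \<Sum>\<^sub>f w f\<close>. Equality holds for the
  \<open>n - 1\<close> maps that increase exactly on a cyclic interval of \<open>t - 1\<close> gaps, each with weight
  \<open>1 / (t - 1)\<close>: every gap lies in exactly \<open>t - 1\<close> of these intervals.
\<close>

lemma finite_monotone_maps: "finite P \<Longrightarrow> finite (monotone_maps P le t)"
  unfolding monotone_maps_def chain_def
  by (rule finite_subset[of _ "P \<rightarrow>\<^sub>E {1..t}"]) (auto intro: finite_PiE)

text \<open>The lower ends of the jumps take distinct values, since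
  \<open>f i < f (Suc i) \<le> f j\<close> for jumps \<open>i < j\<close>. The value
  \<open>t\<close> is not among them, because \<open>f\<close> still increases afterwards.\<close>

lemma card_jumps_le:
  assumes f: "f \<in> monotone_maps (chain n) (\<le>) t"
  shows "card {i \<in> {1..<n}. f i < f (Suc i)} \<le> t - 1"
proof -
  let ?J = "{i \<in> {1..<n}. f i < f (Suc i)}"
  have mono: "f x \<le> f y" if "1 \<le> x" "x \<le> y" "y \<le> n" for x y
    using f that by (auto simp: monotone_maps_def monotone_on_def chain_def)
  have range: "f x \<in> {1..t}" if "1 \<le> x" "x \<le> n" for x
    using f that by (auto simp: monotone_maps_def chain_def PiE_iff)
  have "strict_mono_on ?J f"
  proof (rule strict_mono_onI)
    fix i j assume "i \<in> ?J" "j \<in> ?J" "i < j"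
    then show "f i < f j" using mono[of "Suc i" j] by auto
  qed
  then have "inj_on f ?J" by (rule strict_mono_on_imp_inj_on)
  moreover have "f ` ?J \<subseteq> {1..<t}"
  proof
    fix v assume "v \<in> f ` ?J"
    then obtain i where "i \<in> ?J" "v = f i" by blast
    then show "v \<in> {1..<t}" using range[of i] range[of "Suc i"] by auto
  qed
  ultimately have "card ?J \<le> card {1..<t}" by (intro card_inj_on_le) auto
  then show ?thesis by simp
qed

lemma realiser_weight_ge:
  assumes t: "2 \<le> t" and n: "1 \<le> n" and w: "fractional_realiser t (chain n) (\<le>) w"
  shows "(real n - 1) / (real t - 1) \<le> (\<Sum>f \<in> monotone_maps (chain n) (\<le>) t. w f)"
proof -
  let ?M = "monotone_maps (chain n) (\<le>) t"
  have fin: "finite ?M" by (rule finite_monotone_maps) (simp add: chain_def)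
  have nonneg: "0 \<le> w f" if "f \<in> ?M" for f
    using w that by (simp add: fractional_realiser_def)
  have "1 \<le> (\<Sum>f \<in> {f \<in> ?M. f i < f (Suc i)}. w f)" if "i \<in> {1..<n}" for i
    using w that by (auto simp: fractional_realiser_def chain_def)
  then have "(\<Sum>i \<in> {1..<n}. 1) \<le> (\<Sum>i \<in> {1..<n}. \<Sum>f \<in> {f \<in> ?M. f i < f (Suc i)}. w f)"
    by (rule sum_mono)
  \<comment> \<open>Double counting of the pairs of a gap and a map that increases there.\<close>
  also have "\<dots> = (\<Sum>f \<in> ?M. \<Sum>i \<in> {i \<in> {1..<n}. f i < f (Suc i)}. w f)"
    using fin by (intro sum.swap_restrict) auto
  also have "\<dots> = (\<Sum>f \<in> ?M. real (card {i \<in> {1..<n}. f i < f (Suc i)}) * w f)"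
    by simp
  also have "\<dots> \<le> (\<Sum>f \<in> ?M. real (t - 1) * w f)"
    using card_jumps_le nonneg by (intro sum_mono mult_right_mono) auto
  also have "\<dots> = real (t - 1) * (\<Sum>f \<in> ?M. w f)"
    by (simp add: sum_distrib_left)
  finally show ?thesis
    using t n by (simp add: of_nat_diff field_simps)
qed

text \<open>Shifting by \<open>j\<close> permutes the residues modulo \<open>m\<close>. This is used
  both with \<open>i\<close> as the gap and \<open>j\<close> as the index of a cyclic map, and with
  these roles exchanged.\<close>

lemma card_shifted_mod_less:
  fixes m s j :: nat
  assumes "s \<le> m"
  shows "card {i \<in> {..<m}. (i + j) mod m < s} = s"
proof (cases "m = 0")
  case False
  let ?g = "\<lambda>i. (i + j) mod m"
  have inj: "inj_on ?g {..<m}"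
  proof (rule linorder_inj_onI)
    fix a b assume "a < b" "a \<in> {..<m}" "b \<in> {..<m}"
    \<comment> \<open>The difference is \<open>b - a\<close>, which lies strictly between
      \<open>0\<close> and \<open>m\<close>.\<close>
    then have "\<not> m dvd (b + j) - (a + j)" by (auto dest: dvd_imp_le)
    then show "?g a \<noteq> ?g b"
      using \<open>a < b\<close> mod_eq_dvd_iff_nat[of "a + j" "b + j" m] by simp
  qed auto
  have onto: "?g ` {..<m} = {..<m}"
    using False inj by (intro endo_inj_surj) auto
  have "?g ` {i \<in> {..<m}. ?g i < s} = {v \<in> ?g ` {..<m}. v < s}" by blast
  also have "\<dots> = {..<s}" using onto assms by auto
  finally have "?g ` {i \<in> {..<m}. ?g i < s} = {..<s}" .
  moreover have "inj_on ?g {i \<in> {..<m}. ?g i < s}"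
    using inj by (rule inj_on_subset) auto
  ultimately show ?thesis using card_image by fastforce
qed (use assms in simp)

text \<open>The gap between \<open>i + 1\<close> and \<open>i + 2\<close> has index \<open>i\<close>, for \<open>i < n - 1\<close>.\<close>

definition cyclic_map :: "nat \<Rightarrow> nat \<Rightarrow> nat \<Rightarrow> nat \<Rightarrow> nat" where
  "cyclic_map n t j =
     restrict (\<lambda>x. Suc (card {i \<in> {..<x - 1}. (i + j) mod (n - 1) < t - 1})) (chain n)"

text \<open>The value at \<open>x\<close> is one more than the number of selected gaps below
  \<open>x\<close>, and exactly \<open>t - 1\<close> of all \<open>n - 1\<close> gaps are
  selected.\<close>

lemma cyclic_map_in_monotone_maps:
  assumes "1 \<le> t" "t \<le> n"
  shows "cyclic_map n t j \<in> monotone_maps (chain n) (\<le>) t"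
proof -
  let ?S = "\<lambda>m. {i \<in> {..<m}. (i + j) mod (n - 1) < t - 1}"
  have mono: "card (?S a) \<le> card (?S b)" if "a \<le> b" for a b
    using that by (intro card_mono) auto
  have "card (?S (x - 1)) \<le> t - 1" if "x \<le> n" for x
    using mono[of "x - 1" "n - 1"] card_shifted_mod_less[of "t - 1" "n - 1" j] assms that
    by simp
  then have "Suc (card (?S (x - 1))) \<le> t" if "x \<le> n" for x
    using assms that by (metis Suc_le_mono le_add_diff_inverse plus_1_eq_Suc)
  then show ?thesis
    using mono
    by (auto simp: monotone_maps_def cyclic_map_def monotone_on_def chain_def diff_le_mono)
qed

text \<open>The gap directly above \<open>x\<close> has index \<open>x - 1\<close>; if selected, it
  is counted at \<open>y\<close> but not at \<open>x\<close>.\<close>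

lemma cyclic_map_less:
  assumes "1 \<le> x" "x < y" "y \<le> n" "(x - 1 + j) mod (n - 1) < t - 1"
  shows "cyclic_map n t j x < cyclic_map n t j y"
proof -
  let ?S = "\<lambda>m. {i \<in> {..<m}. (i + j) mod (n - 1) < t - 1}"
  have "x - 1 \<in> ?S (y - 1)" "x - 1 \<notin> ?S (x - 1)" "?S (x - 1) \<subseteq> ?S (y - 1)"
    using assms by auto
  then have "?S (x - 1) \<subset> ?S (y - 1)" by blast
  then have "card (?S (x - 1)) < card (?S (y - 1))" by (intro psubset_card_mono) auto
  then show ?thesis using assms by (simp add: cyclic_map_def chain_def)
qed

text \<open>Counting indices \<open>j\<close> matters because the maps may coincide: for \<open>t = n\<close> all of them do.\<close>

definition cyclic_weight :: "nat \<Rightarrow> nat \<Rightarrow> (nat \<Rightarrow> nat) \<Rightarrow> real" where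
  "cyclic_weight n t f = real (card {j \<in> {..<n - 1}. cyclic_map n t j = f}) / real (t - 1)"

text \<open>Each index \<open>j\<close> gives \<open>1 / (t - 1)\<close> to the single map it
  yields, so a sum over maps becomes a count of indices.\<close>

lemma sum_cyclic_weight:
  assumes "finite A"
  shows "(\<Sum>f \<in> A. cyclic_weight n t f)
       = real (card {j \<in> {..<n - 1}. cyclic_map n t j \<in> A}) / real (t - 1)"
proof -
  have "card {j \<in> {..<n - 1}. cyclic_map n t j \<in> A}
      = card (\<Union>f \<in> A. {j \<in> {..<n - 1}. cyclic_map n t j = f})"
    by (rule arg_cong[of _ _ card]) auto
  also have "\<dots> = (\<Sum>f \<in> A. card {j \<in> {..<n - 1}. cyclic_map n t j = f})"
    using assms by (intro card_UN_disjoint) auto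
  finally show ?thesis
    by (simp add: cyclic_weight_def sum_divide_distrib)
qed

lemma cyclic_weight_realiser:
  assumes t: "2 \<le> t" and n: "t \<le> n"
  shows "fractional_realiser t (chain n) (\<le>) (cyclic_weight n t)"
proof -
  let ?M = "monotone_maps (chain n) (\<le>) t"
  have fin: "finite ?M" by (rule finite_monotone_maps) (simp add: chain_def)
  have "1 \<le> (\<Sum>f \<in> {f \<in> ?M. f x < f y}. cyclic_weight n t f)"
    if xy: "x \<in> chain n" "y \<in> chain n" "\<not> y \<le> x" for x y
  proof -
    \<comment> \<open>Here the gap \<open>x - 1\<close> is fixed and the index \<open>j\<close>
      varies: exactly \<open>t - 1\<close> indices select the gap directly above \<open>x\<close>,
      which suffices for every \<open>y\<close> above \<open>x\<close>.\<close>
    have "t - 1 = card {j \<in> {..<n - 1}. (j + (x - 1)) mod (n - 1) < t - 1}"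
      using n by (intro card_shifted_mod_less[symmetric]) simp
    also have "\<dots> \<le> card {j \<in> {..<n - 1}. cyclic_map n t j \<in> {f \<in> ?M. f x < f y}}"
      using t n xy cyclic_map_in_monotone_maps[of t n] cyclic_map_less[of x y n _ t]
      by (intro card_mono) (auto simp: chain_def add.commute)
    finally show ?thesis
      using t fin by (subst sum_cyclic_weight) (simp_all add: field_simps)
  qed
  then show ?thesis
    by (auto simp: fractional_realiser_def cyclic_weight_def)
qed

theorem theorem9:
  fixes n t :: nat
  assumes "2 \<le> t" and "t \<le> n"
  shows "fdim t (chain n) (\<le>) = (real n - 1) / (real t - 1)"
proof -
  let ?M = "monotone_maps (chain n) (\<le>) t"
  have "finite ?M" by (rule finite_monotone_maps) (simp add: chain_def)
  then have "(\<Sum>f \<in> ?M. cyclic_weight n t f)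
      = real (card {j \<in> {..<n - 1}. cyclic_map n t j \<in> ?M}) / real (t - 1)"
    by (rule sum_cyclic_weight)
  also have "{j \<in> {..<n - 1}. cyclic_map n t j \<in> ?M} = {..<n - 1}"
    using assms cyclic_map_in_monotone_maps[of t n] by auto
  finally have "(real n - 1) / (real t - 1) = (\<Sum>f \<in> ?M. cyclic_weight n t f)"
    using assms by (simp add: of_nat_diff)
  then show ?thesis
    unfolding fdim_def
    using assms cyclic_weight_realiser[OF assms] realiser_weight_ge[of t n]
    by (intro Least_equality) auto
qed

end
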